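(* Let $L,n\in\mathbb{N}$, let $z\in\mathcal{T}_L$, and let $W,W'\in\{F,B\}^n$ be two sequences. Then the set of triangular paths in $\mathcal{T}_L$ starting from $z$ with direction vector $W$ is in bijection with the set of triangular paths in $\mathcal{T}_L$ starting from $z$ with direction vector $W'$.
   Context: $\mathbb{N}=\{0,1,2,\dots\}$ and $(e_1,e_2,e_3)$ is the standard basis of $\mathbb{R}^3$. For $L\in\mathbb{N}$, $\mathcal{T}_L=\{x_1e_1+x_2e_2+x_3e_3 : x_1,x_2,x_3\in\mathbb{N},\ x_1+x_2+x_3=L\}$. Forward steps: $s_1=e_1-e_3$, $s_2=e_2-e_1$, $s_3=e_3-e_2$. Backward steps: $\overline{s_i}=-s_i$ for $i\in\{1,2,3\}$. A triangular path of length $n$ starting from $z\in\mathcal{T}_L$ is a sequence $(\omega_1,\dots,\omega_n)\in\{s_1,s_2,s_3,\overline{s_1},\overline{s_2},\overline{s_3}\}^n$ such that $z+\sum_{i=1}^k\omega_i\in\mathcal{T}_L$ for all $k\in\{0,\dots,n\}$. Its direction vector is the sequence $(D_1,\dots,D_n)$ with $D_i=F$ if $\omega_i$ is a forward step and $D_i=B$ if $\omega_i$ is a backward step. *)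

theory Defs
  imports "HOL-Analysis.Analysis"
begin

(* The index type 3 has the elements 1, 2 and 3 (with 3 = 0), so that
   "e 1", "e 2", "e 3" are the three standard basis vectors. *)
definition e :: "3 \<Rightarrow> real ^ 3" where
  "e i = axis i 1"

definition triangle_points :: "nat \<Rightarrow> (real ^ 3) set" where
  "triangle_points L = {real x1 *\<^sub>R e 1 + real x2 *\<^sub>R e 2 + real x3 *\<^sub>R e 3 | x1 x2 x3 :: nat. x1 + x2 + x3 = L}"

definition forward_steps :: "(real ^ 3) set" where
  "forward_steps = {e 1 - e 3, e 2 - e 1, e 3 - e 2}"

definition backward_steps :: "(real ^ 3) set" where
  "backward_steps = uminus ` forward_steps"

(* The list entry w ! i is the (i+1)-st step, so "take k w" consists of the first k steps. *)
definition triangular_path :: "nat \<Rightarrow> nat \<Rightarrow> real ^ 3 \<Rightarrow> (real ^ 3) list \<Rightarrow> bool" where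
  "triangular_path L n z w \<longleftrightarrow>
     length w = n \<and> set w \<subseteq> forward_steps \<union> backward_steps \<and>
     (\<forall>k\<in>{0..n}. z + sum_list (take k w) \<in> triangle_points L)"

datatype direction = Forward | Backward

(* Only meaningful on forward_steps \<union> backward_steps, which is a disjoint union (see below). *)
definition direction_of :: "real ^ 3 \<Rightarrow> direction" where
  "direction_of v = (if v \<in> forward_steps then Forward else Backward)"

definition direction_vector :: "(real ^ 3) list \<Rightarrow> direction list" where
  "direction_vector w = map direction_of w"

lemma forward_backward_disjoint: "forward_steps \<inter> backward_steps = {}"
proof -
  have "v \<notin> backward_steps" if "v \<in> forward_steps" for v
    using that unfolding forward_steps_def backward_steps_def e_def
    by (auto simp: vec_eq_iff forall_3 axis_def)
  then show ?thesis by blast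
qed

lemma direction_of_backward: "v \<in> backward_steps \<Longrightarrow> direction_of v = Backward"
  using forward_backward_disjoint by (auto simp: direction_of_def)

end

(* The number of paths from z with direction vector W is obtained by applying to the constant
   function 1 one transfer operator per letter of W.  The two transfer operators commute on the
   triangle: s_i - s_j with i \<noteq> j can be walked in either order, because its partial sums only
   decrease coordinates that the endpoint decreases as well, and at each point there are as many
   loops s_i - s_i as loops - s_i + s_i, namely the number of nonzero coordinates.  For the same
   reason they agree on constants.  So letters can be swapped and the last letter can be changed
   without affecting the number of paths. *)

theory Submission
  imports Defs
begin

primrec steps :: "direction \<Rightarrow> (real ^ 3) set" where
  "steps Forward = forward_steps"
| "steps Backward = backward_steps"

lemma finite_steps: "finite (steps d)"
  by (cases d) (auto simp: forward_steps_def backward_steps_def)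

lemma mem_steps_iff:
  "s \<in> steps d \<longleftrightarrow> s \<in> forward_steps \<union> backward_steps \<and> direction_of s = d"
  using forward_backward_disjoint by (cases d) (auto simp: direction_of_def)

text \<open>If \<open>f v\<close> counts the paths from \<open>v\<close> with direction vector
  \<open>W\<close>, then \<open>transfer L d f z\<close> counts those from \<open>z\<close> with
  direction vector \<open>d # W\<close>. Steps that leave the triangle contribute 0.\<close>

definition transfer :: "nat \<Rightarrow> direction \<Rightarrow> (real ^ 3 \<Rightarrow> nat) \<Rightarrow> real ^ 3 \<Rightarrow> nat" where
  "transfer L d f z = (\<Sum>s\<in>steps d. if z + s \<in> triangle_points L then f (z + s) else 0)"

definition point :: "nat \<Rightarrow> nat \<Rightarrow> nat \<Rightarrow> real ^ 3" where
  "point a b c = real a *\<^sub>R e 1 + real b *\<^sub>R e 2 + real c *\<^sub>R e 3"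

lemma triangle_points_eq: "triangle_points L = {point a b c | a b c. a + b + c = L}"
  by (simp add: triangle_points_def point_def)

lemma point_mem: "a + b + c = L \<Longrightarrow> point a b c \<in> triangle_points L"
  by (auto simp: triangle_points_eq)

lemma triangle_points_nonneg: "v \<in> triangle_points L \<Longrightarrow> 0 \<le> v $ i"
  by (auto simp: triangle_points_def e_def axis_def)

lemma point_add_step:
  "point (Suc a) b c + (e 2 - e 1) = point a (Suc b) c"
  "point (Suc a) b c + (e 3 - e 1) = point a b (Suc c)"
  "point a (Suc b) c + (e 1 - e 2) = point (Suc a) b c"
  "point a (Suc b) c + (e 3 - e 2) = point a b (Suc c)"
  "point a b (Suc c) + (e 1 - e 3) = point (Suc a) b c"
  "point a b (Suc c) + (e 2 - e 3) = point a (Suc b) c"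
  by (simp_all add: point_def algebra_simps)

text \<open>The coordinate that the step decreases would become -1.\<close>

lemma point_add_step_notin:
  "point 0 b c + (e 2 - e 1) \<notin> triangle_points L"
  "point 0 b c + (e 3 - e 1) \<notin> triangle_points L"
  "point a 0 c + (e 1 - e 2) \<notin> triangle_points L"
  "point a 0 c + (e 3 - e 2) \<notin> triangle_points L"
  "point a b 0 + (e 1 - e 3) \<notin> triangle_points L"
  "point a b 0 + (e 2 - e 3) \<notin> triangle_points L"
  using triangle_points_nonneg[of _ L 1] triangle_points_nonneg[of _ L 2]
    triangle_points_nonneg[of _ L 3]
  by (fastforce simp: point_def e_def axis_def)+

text \<open>Turns each membership test into a case distinction on the natural number that the step
  decreases, so that later identities of \<open>transfer\<close> become arithmetic.\<close>

lemma if_mem_triangle_points: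
  assumes "a + b + c = L"
  shows
    "(if point a b c + (e 1 - e 3) \<in> triangle_points L then f (point a b c + (e 1 - e 3)) else 0)
      = (case c of 0 \<Rightarrow> 0 | Suc c' \<Rightarrow> (f (point (Suc a) b c') :: nat))"
    "(if point a b c + (e 2 - e 1) \<in> triangle_points L then f (point a b c + (e 2 - e 1)) else 0)
      = (case a of 0 \<Rightarrow> 0 | Suc a' \<Rightarrow> f (point a' (Suc b) c))"
    "(if point a b c + (e 3 - e 2) \<in> triangle_points L then f (point a b c + (e 3 - e 2)) else 0)
      = (case b of 0 \<Rightarrow> 0 | Suc b' \<Rightarrow> f (point a b' (Suc c)))"
    "(if point a b c + (e 3 - e 1) \<in> triangle_points L then f (point a b c + (e 3 - e 1)) else 0)
      = (case a of 0 \<Rightarrow> 0 | Suc a' \<Rightarrow> f (point a' b (Suc c)))"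
    "(if point a b c + (e 1 - e 2) \<in> triangle_points L then f (point a b c + (e 1 - e 2)) else 0)
      = (case b of 0 \<Rightarrow> 0 | Suc b' \<Rightarrow> f (point (Suc a) b' c))"
    "(if point a b c + (e 2 - e 3) \<in> triangle_points L then f (point a b c + (e 2 - e 3)) else 0)
      = (case c of 0 \<Rightarrow> 0 | Suc c' \<Rightarrow> f (point a (Suc b) c'))"
  using assms
  by (auto simp: point_add_step point_add_step_notin point_mem split: nat.split)

text \<open>Ensures that a sum over a set of three steps really has three summands.\<close>

lemma distinct_steps:
  "e 1 - e 3 \<noteq> e 2 - e 1" "e 1 - e 3 \<noteq> e 3 - e 2" "e 2 - e 1 \<noteq> e 3 - e 2"
  "e 3 - e 1 \<noteq> e 1 - e 2" "e 3 - e 1 \<noteq> e 2 - e 3" "e 1 - e 2 \<noteq> e 2 - e 3"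
  by (simp_all add: e_def vec_eq_iff forall_3 axis_def)

lemma transfer_point:
  assumes "a + b + c = L"
  shows "transfer L Forward f (point a b c) =
      (case c of 0 \<Rightarrow> 0 | Suc c' \<Rightarrow> f (point (Suc a) b c')) +
      (case a of 0 \<Rightarrow> 0 | Suc a' \<Rightarrow> f (point a' (Suc b) c)) +
      (case b of 0 \<Rightarrow> 0 | Suc b' \<Rightarrow> f (point a b' (Suc c)))"
    and "transfer L Backward f (point a b c) =
      (case c of 0 \<Rightarrow> 0 | Suc c' \<Rightarrow> f (point a (Suc b) c')) +
      (case a of 0 \<Rightarrow> 0 | Suc a' \<Rightarrow> f (point a' b (Suc c))) +
      (case b of 0 \<Rightarrow> 0 | Suc b' \<Rightarrow> f (point (Suc a) b' c))"
  unfolding transfer_def steps.simps backward_steps_def forward_steps_def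
    image_insert image_empty minus_diff_eq
  by (simp_all only: sum.insert finite.intros insert_iff empty_iff distinct_steps
      distinct_steps[symmetric] sum.empty if_mem_triangle_points[OF assms] simp_thms add_0_right add.assoc)

lemma transfer_commute:
  assumes "z \<in> triangle_points L"
  shows "transfer L Backward (transfer L Forward f) z = transfer L Forward (transfer L Backward f) z"
proof -
  obtain a b c where "z = point a b c" "a + b + c = L"
    using assms by (auto simp: triangle_points_eq)
  then show ?thesis
    \<comment> \<open>Fixing which coordinates vanish makes the points after the first step
      explicit, so that the premise of \<open>transfer_point\<close> can be checked there as well.
      The split treats the second step.\<close>
    by (cases a; cases b; cases c) (simp_all add: transfer_point split: nat.split)
qed

text \<open>Each coordinate is decreased by exactly one forward and one backward step, so both sides
  are \<open>k\<close> times the number of nonzero coordinates.\<close>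

lemma transfer_const:
  assumes "z \<in> triangle_points L"
  shows "transfer L Backward (\<lambda>_. k) z = transfer L Forward (\<lambda>_. k) z"
  using assms by (auto simp: triangle_points_eq transfer_point split: nat.split)

text \<open>Allows identities known only on the triangle to be used beneath another
  operator.\<close>

lemma transfer_cong:
  assumes "\<And>v. v \<in> triangle_points L \<Longrightarrow> f v = g v"
  shows "transfer L d f = transfer L d g"
  unfolding transfer_def using assms by (intro ext sum.cong) auto

text \<open>The backward operator moves inward past the forward ones until it meets the constant,
  where it may be replaced by a forward one.\<close>

lemma transfer_Backward_Forward_funpow:
  assumes "z \<in> triangle_points L"
  shows "transfer L Backward ((transfer L Forward ^^ n) (\<lambda>_. k)) z
    = (transfer L Forward ^^ Suc n) (\<lambda>_. k) z"
  using assms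
proof (induction n arbitrary: z)
  case 0
  then show ?case by (simp add: transfer_const)
next
  case (Suc n)
  have "transfer L Forward (transfer L Backward ((transfer L Forward ^^ n) (\<lambda>_. k)))
      = transfer L Forward ((transfer L Forward ^^ Suc n) (\<lambda>_. k))"
    by (rule transfer_cong) (rule Suc.IH)
  with Suc.prems show ?case by (simp add: transfer_commute)
qed

definition paths :: "nat \<Rightarrow> real ^ 3 \<Rightarrow> direction list \<Rightarrow> (real ^ 3) list set" where
  "paths L z W = {w. triangular_path L (length W) z w \<and> direction_vector w = W}"

lemma triangular_path_Cons:
  "triangular_path L (Suc n) z (s # w) \<longleftrightarrow>
    z \<in> triangle_points L \<and> s \<in> forward_steps \<union> backward_steps \<and> triangular_path L n (z + s) w"
proof -
  \<comment> \<open>The empty prefix gives the condition on \<open>z\<close>; all other prefixes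
    begin with \<open>s\<close>.\<close>
  have "(\<forall>k\<in>{0..Suc n}. P k) \<longleftrightarrow> P 0 \<and> (\<forall>k\<in>{0..n}. P (Suc k))" for P
    by (simp add: Ball_def less_Suc_eq_le[symmetric] All_less_Suc2)
  then show ?thesis
    by (auto simp: triangular_path_def add.assoc)
qed

lemma triangular_path_start: "triangular_path L n z w \<Longrightarrow> z \<in> triangle_points L"
  unfolding triangular_path_def by (force dest: bspec[where x = 0])

lemma paths_Nil: "z \<in> triangle_points L \<Longrightarrow> paths L z [] = {[]}"
  by (auto simp: paths_def triangular_path_def direction_vector_def)

text \<open>The union carries the same test as \<open>transfer\<close>, so that cardinalities match
  summand by summand.\<close>

lemma paths_Cons:
  assumes "z \<in> triangle_points L"
  shows "paths L z (d # W) =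
    (\<Union>s\<in>steps d. if z + s \<in> triangle_points L then Cons s ` paths L (z + s) W else {})"
    (is "?A = ?B")
proof (rule set_eqI)
  fix w
  show "w \<in> ?A \<longleftrightarrow> w \<in> ?B"
    using assms
    by (cases w) (auto simp: paths_def direction_vector_def triangular_path_Cons mem_steps_iff
        dest: triangular_path_start split: if_splits)
qed

text \<open>The count depends on \<open>W\<close> only through its length. Finiteness is part of the
  induction because the cardinality of the union relies on it.\<close>

lemma card_paths:
  assumes "z \<in> triangle_points L"
  shows "finite (paths L z W) \<and>
    card (paths L z W) = (transfer L Forward ^^ length W) (\<lambda>_. 1) z"
  using assms
proof (induction W arbitrary: z)
  case Nil
  then show ?case by (simp add: paths_Nil)
next
  case (Cons d W)
  let ?f = "(transfer L Forward ^^ length W) (\<lambda>_. 1)"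
  let ?P = "\<lambda>s. if z + s \<in> triangle_points L then Cons s ` paths L (z + s) W else {}"
  have fin: "finite (?P s)" for s
    using Cons.IH by simp
  have "card (paths L z (d # W)) = (\<Sum>s\<in>steps d. card (?P s))"
    unfolding paths_Cons[OF Cons.prems]
    \<comment> \<open>Paths with different first steps are different.\<close>
    by (rule card_UN_disjoint) (use finite_steps fin in auto)
  also have "\<dots> = transfer L d ?f z"
    unfolding transfer_def[of L d] using Cons.IH by (intro sum.cong) (auto simp: card_image)
  also have "\<dots> = (transfer L Forward ^^ length (d # W)) (\<lambda>_. 1) z"
    \<comment> \<open>By induction the tail already counts as all-forward; a leading
      \<open>Backward\<close> is now exchanged for \<open>Forward\<close>.\<close>
    using transfer_Backward_Forward_funpow[OF Cons.prems] by (cases d) auto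
  finally show ?case
    unfolding paths_Cons[OF Cons.prems] using finite_steps fin by blast
qed

theorem theorem6:
  fixes L n :: nat and z :: "real ^ 3" and W W' :: "direction list"
  assumes "z \<in> triangle_points L"
    and "length W = n" and "length W' = n"
  shows "\<exists>f. bij_betw f
           {w. triangular_path L n z w \<and> direction_vector w = W}
           {w. triangular_path L n z w \<and> direction_vector w = W'}"
proof -
  have "\<exists>f. bij_betw f (paths L z W) (paths L z W')"
    \<comment> \<open>The bijection is not explicit: it comes from two finite sets having equal
      cardinality.\<close>
    using card_paths[OF assms(1)] assms(2,3) by (intro finite_same_card_bij) simp_all
  with assms(2,3) show ?thesis
    by (simp add: paths_def)
qed

end
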